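(* Let $k,a\in\mathbb{N}$ and let $p_1,\ldots,p_k\in\mathbb{Q}[t]$ be polynomials with zero constant term. For any finite coloring of $\mathbb{Q}$, the following hold: (1) there exist a non-zero $y\in\mathbb{Q}$ and an infinite subset $A$ of $\mathbb{Q}\setminus\{0\}$ such that $$A\cup (y^{-a}\cdot A)\cup (A+\{p_i(y):1\le i\le k\})$$ is monochromatic; (2) there exist a non-zero $u\in\mathbb{Q}$ and an infinite subset $B$ of $\mathbb{Q}\setminus\{0\}$ such that $$B\cup (u^{a}\cdot B)\cup (B+\{p_i(u):1\le i\le k\})$$ is monochromatic.
   Context: $\mathbb{N}=\{1,2,3,\ldots\}$. A finite coloring of $\mathbb{Q}$ is a partition of $\mathbb{Q}$ into finitely many classes (colors); a set is monochromatic if it is contained in a single color class. For $c\in\mathbb{Q}$ and $A,E\subset\mathbb{Q}$, $c\cdot A=\{cx:x\in A\}$ and $A+E=\{x+e:x\in A,\ e\in E\}$. *)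

theory Defs
  imports
    Complex_Main
    "HOL-Library.Disjoint_Sets"
    "HOL-Library.Set_Algebras"
    "HOL-Computational_Algebra.Polynomial"
begin

definition finite_coloring :: "rat set set \<Rightarrow> bool" where
  "finite_coloring \<C> \<longleftrightarrow> partition_on UNIV \<C> \<and> finite \<C>"

definition monochromatic :: "rat set set \<Rightarrow> rat set \<Rightarrow> bool" where
  "monochromatic \<C> S \<longleftrightarrow> (\<exists>C\<in>\<C>. S \<subseteq> C)"

end

theory Submission
  imports Defs "HOL-Library.Multiset"
begin

text \<open>
  Piecewise syndetic subsets of \<open>\<rat>\<close> are infinite, partition regular and invariant under dilation.
  By the polynomial van der Waerden theorem, proved by Walters' colour-focusing form of
  PET induction, a piecewise syndetic \<open>B\<close> contains a piecewise syndetic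
  \<open>D = {x \<in> B. \<forall>g\<in>G. x + g y \<in> B}\<close> for some \<open>y > 0\<close>. Following Moreira, iterate: pass from \<open>B\<close> to
  \<open>D\<close>, dilate by \<open>y powi e\<close>, and restrict to a colour class that keeps the set piecewise syndetic.
  After finitely many rounds a colour recurs. If \<open>u\<close> is the product of the values \<open>y\<close> used between the
  two occurrences and \<open>A\<close> is the last set divided by \<open>u powi e\<close>, then \<open>A\<close>,
  \<open>u powi e * A\<close> and the shifts of \<open>A\<close> all lie in that colour, provided \<open>G\<close> was chosen at
  each round to cover every earlier starting point. The two parts are \<open>e = - a\<close> and \<open>e = a\<close>.
\<close>

section \<open>Piecewise syndetic sets\<close>

definition thick :: "'a::ab_group_add set \<Rightarrow> bool" where
  "thick T \<longleftrightarrow> (\<forall>E. finite E \<longrightarrow> (\<exists>t. \<forall>e\<in>E. t + e \<in> T))"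

definition piecewise_syndetic :: "'a::ab_group_add set \<Rightarrow> bool" where
  "piecewise_syndetic A \<longleftrightarrow> (\<exists>F. finite F \<and> thick {x. \<exists>f\<in>F. x + f \<in> A})"

lemma thickD: "thick T \<Longrightarrow> finite E \<Longrightarrow> \<exists>t. \<forall>e\<in>E. t + e \<in> T"
  by (simp add: thick_def)

lemma not_thickD: "\<not> thick T \<Longrightarrow> \<exists>E. finite E \<and> (\<forall>t. \<exists>e\<in>E. t + e \<notin> T)"
  by (simp add: thick_def)

lemma thick_infinite:
  fixes T :: "'a::{ab_group_add, ring_char_0} set"
  assumes "thick T"
  shows "infinite T"
proof
  assume fin: "finite T"
  \<comment> \<open>The naturals up to \<open>card T\<close> stay distinct in characteristic 0, so
    \<open>E\<close> is one element too large for a translate of it to fit into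
    \<open>T\<close>.\<close>
  define E :: "'a set" where "E = of_nat ` {..card T}"
  have cE: "card E = Suc (card T)"
    unfolding E_def by (subst card_image) (auto simp: inj_on_def)
  obtain t where "\<forall>e\<in>E. t + e \<in> T"
    using thickD[OF assms, of E] unfolding E_def by auto
  then have "(+) t ` E \<subseteq> T" by auto
  then have "card ((+) t ` E) \<le> card T"
    using fin card_mono by blast
  moreover have "card ((+) t ` E) = card E"
    by (rule card_image) auto
  ultimately show False using cE by simp
qed

lemma piecewise_syndetic_UNIV: "piecewise_syndetic UNIV"
  unfolding piecewise_syndetic_def thick_def by (rule exI[of _ "{0}"]) simp

lemma not_piecewise_syndetic_empty: "\<not> piecewise_syndetic {}"
  unfolding piecewise_syndetic_def thick_def by auto

lemma piecewise_syndetic_infinite: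
  fixes A :: "'a::{ab_group_add, ring_char_0} set"
  assumes "piecewise_syndetic A"
  shows "infinite A"
proof
  assume fin: "finite A"
  obtain F where F: "finite F" "thick {x. \<exists>f\<in>F. x + f \<in> A}"
    using assms unfolding piecewise_syndetic_def by blast
  have "{x. \<exists>f\<in>F. x + f \<in> A} \<subseteq> (\<lambda>(a, f). a - f) ` (A \<times> F)"
    by (force simp: image_iff)
  then have "finite {x. \<exists>f\<in>F. x + f \<in> A}"
    by (rule finite_subset) (use fin F in auto)
  then show False using thick_infinite F by blast
qed

text \<open>If the \<open>F\<close>-translates of \<open>B\<close> do not form a thick set, some
  finite \<open>E\<close> has a point outside them in each of its translates. Within the thick set
  of \<open>A \<union> B\<close>, such a point is taken into \<open>A\<close> by \<open>F\<close>,
  so the sumset of \<open>E\<close> and \<open>F\<close> serves \<open>A\<close>.\<close>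

lemma piecewise_syndetic_Un:
  assumes "piecewise_syndetic (A \<union> B)"
  shows "piecewise_syndetic A \<or> piecewise_syndetic B"
proof (rule disjCI)
  assume nB: "\<not> piecewise_syndetic B"
  obtain F where F: "finite F" "thick {x. \<exists>f\<in>F. x + f \<in> A \<union> B}"
    using assms unfolding piecewise_syndetic_def by blast
  have "\<not> thick {x. \<exists>f\<in>F. x + f \<in> B}"
    using nB F unfolding piecewise_syndetic_def by blast
  from not_thickD[OF this]
  obtain E where E: "finite E" "\<And>t. \<exists>e\<in>E. t + e \<notin> {x. \<exists>f\<in>F. x + f \<in> B}"
    by (elim exE conjE) (rule that, assumption, rule spec)
  show "piecewise_syndetic A"
    unfolding piecewise_syndetic_def
  proof (intro exI[of _ "(\<lambda>(e, f). e + f) ` (E \<times> F)"] conjI)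
    show "finite ((\<lambda>(e, f). e + f) ` (E \<times> F))" using E F by auto
    show "thick {x. \<exists>g\<in>(\<lambda>(e, f). e + f) ` (E \<times> F). x + g \<in> A}"
      unfolding thick_def
    proof (intro allI impI)
      fix E' :: "'a set" assume "finite E'"
      then have "finite ((\<lambda>(e, f). e + f) ` (E' \<times> E))" using E by auto
      from thickD[OF F(2) this] obtain t where
        t: "\<And>e' e. e' \<in> E' \<Longrightarrow> e \<in> E \<Longrightarrow> \<exists>f\<in>F. t + (e' + e) + f \<in> A \<union> B"
        by auto
      have "\<exists>g\<in>(\<lambda>(e, f). e + f) ` (E \<times> F). t + e' + g \<in> A" if e': "e' \<in> E'" for e'
      proof -
        obtain e where e: "e \<in> E" "t + e' + e \<notin> {x. \<exists>f\<in>F. x + f \<in> B}"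
          using E(2) by blast
        obtain f where f: "f \<in> F" "t + (e' + e) + f \<in> A \<union> B"
          using t[OF e' e(1)] by blast
        have "t + e' + (e + f) \<in> A" using e f by (auto simp: add.assoc)
        then show ?thesis using e(1) f(1) by force
      qed
      then show "\<exists>t. \<forall>e\<in>E'. t + e \<in> {x. \<exists>g\<in>(\<lambda>(e, f). e + f) ` (E \<times> F). x + g \<in> A}"
        by blast
    qed
  qed
qed

lemma piecewise_syndetic_UN:
  assumes "finite I" "piecewise_syndetic (\<Union>i\<in>I. A i)"
  shows "\<exists>i\<in>I. piecewise_syndetic (A i)"
  using assms
proof (induction I rule: finite_induct)
  case empty
  then show ?case by (simp add: not_piecewise_syndetic_empty)
next
  case (insert i I)
  then show ?case using piecewise_syndetic_Un[of "A i" "\<Union>i\<in>I. A i"] by auto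
qed

lemma piecewise_syndetic_dilate:
  fixes A :: "'a::field set"
  assumes "piecewise_syndetic A" "c \<noteq> 0"
  shows "piecewise_syndetic ((*) c ` A)"
proof -
  obtain F where F: "finite F" "thick {x. \<exists>f\<in>F. x + f \<in> A}"
    using assms unfolding piecewise_syndetic_def by blast
  have "thick {x. \<exists>f\<in>(*) c ` F. x + f \<in> (*) c ` A}"
    unfolding thick_def
  proof (intro allI impI)
    fix E :: "'a set" assume "finite E"
    then have "finite ((\<lambda>e. e / c) ` E)" by simp
    from thickD[OF F(2) this] obtain t where t: "\<And>e. e \<in> E \<Longrightarrow> \<exists>f\<in>F. t + e / c + f \<in> A"
      by auto
    have "\<exists>f\<in>(*) c ` F. c * t + e + f \<in> (*) c ` A" if e: "e \<in> E" for e
    proof -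
      obtain f where f: "f \<in> F" "t + e / c + f \<in> A" using t[OF e] by blast
      have "c * t + e + c * f = c * (t + e / c + f)"
        using assms(2) by (simp add: field_simps)
      then show ?thesis using f by blast
    qed
    then show "\<exists>t. \<forall>e\<in>E. t + e \<in> {x. \<exists>f\<in>(*) c ` F. x + f \<in> (*) c ` A}" by blast
  qed
  then show ?thesis using F(1) unfolding piecewise_syndetic_def by blast
qed

section \<open>The polynomial van der Waerden theorem\<close>

text \<open>A finitary form: \<open>X\<close> and \<open>R\<close> serve all colourings at once, so
  that bounds can be composed in the focusing argument and applied around every point of a thick
  set.\<close>

definition vdW_bound ::
  "'a::linordered_field poly set \<Rightarrow> 'b set \<Rightarrow> 'a set \<Rightarrow> 'a set \<Rightarrow> bool" where
  "vdW_bound G K X R \<longleftrightarrow> finite X \<and> finite R \<and> R \<subseteq> {0<..} \<and>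
     (\<forall>c :: 'a \<Rightarrow> 'b. (\<forall>x. c x \<in> K) \<longrightarrow>
        (\<exists>x\<in>X. \<exists>y\<in>R. \<forall>g\<in>G. c (x + poly g y) = c x))"

definition poly_vdW :: "'a::linordered_field poly set \<Rightarrow> bool" where
  "poly_vdW G \<longleftrightarrow> (\<forall>k::nat. \<exists>X R. vdW_bound G {..<k} X R)"

text \<open>Later colours are functions on a finite set or field elements; an injection into the
  naturals relabels them.\<close>

lemma poly_vdW_finite_range:
  fixes G :: "'a::linordered_field poly set" and K :: "'b set"
  assumes "poly_vdW G" "finite K"
  shows "\<exists>X R. vdW_bound G K X R"
proof -
  obtain h :: "'b \<Rightarrow> nat" and k where h: "h ` K = {i. i < k}" "inj_on h K"
    using finite_imp_inj_to_nat_seg[OF assms(2)] by blast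
  obtain X R where XR: "vdW_bound G {..<k} X R"
    using assms(1) unfolding poly_vdW_def by blast
  have "\<exists>x\<in>X. \<exists>y\<in>R. \<forall>g\<in>G. c (x + poly g y) = c x" if c: "\<forall>x. c x \<in> K" for c :: "'a \<Rightarrow> 'b"
  proof -
    have "\<forall>x. (h \<circ> c) x \<in> {..<k}" using h(1) c by auto
    then have "\<exists>x\<in>X. \<exists>y\<in>R. \<forall>g\<in>G. (h \<circ> c) (x + poly g y) = (h \<circ> c) x"
      using XR unfolding vdW_bound_def by metis
    then show ?thesis using h(2) c by (auto simp: inj_on_eq_iff)
  qed
  then have "vdW_bound G K X R" using XR by (simp add: vdW_bound_def)
  then show ?thesis by blast
qed

section \<open>PET induction: differencing and descent of the weight\<close>

text \<open>Polynomials count as equivalent if they agree in degree and leading coefficient; the weight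
  is the multiset of the degrees of the equivalence classes.\<close>

definition pet_weight :: "'a::zero poly set \<Rightarrow> nat multiset" where
  "pet_weight G = image_mset fst (mset_set ((\<lambda>p. (degree p, lead_coeff p)) ` G))"

text \<open>The error of refocusing: when the focus moves back by \<open>p1 y\<close> and the
  difference grows from \<open>d\<close> to \<open>d + y\<close>, the point reached through
  \<open>p\<close> moves by the value of \<open>pet_shift p1 p d\<close> at
  \<open>y\<close>.\<close>

definition pet_shift :: "'a::comm_ring_1 poly \<Rightarrow> 'a poly \<Rightarrow> 'a \<Rightarrow> 'a poly" where
  "pet_shift p1 p d = pcompose p [:d, 1:] - [:poly p d:] - p1"

lemma poly_pet_shift: "poly (pet_shift p1 p d) y = poly p (d + y) - poly p d - poly p1 y"
  by (simp add: pet_shift_def poly_pcompose)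

lemma coeff_0_pet_shift: "coeff p1 0 = 0 \<Longrightarrow> coeff (pet_shift p1 p d) 0 = 0"
  using poly_pet_shift[of p1 p d 0] by (simp add: poly_0_coeff_0)

lemma coeff_pet_shift_degree:
  fixes p :: "'a::idom poly"
  assumes "degree p > 0"
  shows "coeff (pet_shift p1 p d) (degree p) = lead_coeff p - coeff p1 (degree p)"
proof -
  have "coeff (pcompose p [:d, 1:]) (degree p) = lead_coeff p"
    using lead_coeff_comp[of "[:d, 1:]" p] by (simp add: degree_pcompose)
  moreover have "coeff [:poly p d:] (degree p) = 0"
    using assms by (simp add: coeff_pCons split: nat.splits)
  ultimately show ?thesis by (simp add: pet_shift_def)
qed

lemma degree_pet_shift_le:
  fixes p :: "'a::idom poly"
  assumes "degree p1 \<le> degree p"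
  shows "degree (pet_shift p1 p d) \<le> degree p"
  unfolding pet_shift_def using assms
  by (intro degree_diff_le) (auto simp: degree_pcompose)

text \<open>Differencing against \<open>p1\<close> of least degree fixes every class of larger
  degree and, in the least degree, translates leading coefficients by that of \<open>p1\<close>. The
  class of \<open>p1\<close> itself cancels, so one copy of \<open>degree p1\<close> is traded for
  smaller degrees.\<close>

lemma pet_weight_decreases:
  fixes G :: "'a::idom poly set"
  assumes fin: "finite G" "finite D" and p1: "p1 \<in> G"
    and min: "\<And>p. p \<in> G \<Longrightarrow> degree p1 \<le> degree p" and pos: "degree p1 > 0"
  shows "(pet_weight ((\<lambda>(p, d). pet_shift p1 p d) ` (G \<times> D) - {0}), pet_weight G) \<in> mult less_than"
proof -
  define cl :: "'a poly \<Rightarrow> nat \<times> 'a" where "cl = (\<lambda>p. (degree p, lead_coeff p))"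
  define \<phi> :: "nat \<times> 'a \<Rightarrow> nat \<times> 'a" where
    "\<phi> = (\<lambda>(n, b). (n, if n = degree p1 then b - lead_coeff p1 else b))"
  define G' where "G' = (\<lambda>(p, d). pet_shift p1 p d) ` (G \<times> D) - {0}"
  define H where "H = {z \<in> cl ` G'. degree p1 \<le> fst z}"
  define L where "L = {z \<in> cl ` G'. fst z < degree p1}"
  define C where "C = cl ` G - {cl p1}"
  have finG': "finite G'" using fin by (simp add: G'_def)
  have finH: "finite H" and finL: "finite L" and finC: "finite C"
    using finG' fin by (auto simp: H_def L_def C_def)
  have "H \<subseteq> \<phi> ` C"
  proof
    fix z assume "z \<in> H"
    then obtain q where "q \<in> G'" "z = cl q" "degree p1 \<le> degree q"
      by (auto simp: H_def cl_def)
    then obtain p d where p: "p \<in> G" "d \<in> D" "pet_shift p1 p d \<noteq> 0"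
      and z: "z = cl (pet_shift p1 p d)" "degree p1 \<le> degree (pet_shift p1 p d)"
      by (auto simp: G'_def)
    let ?q = "pet_shift p1 p d"
    have le: "degree ?q \<le> degree p" using degree_pet_shift_le min p(1) by blast
    have cf: "coeff ?q (degree p) = lead_coeff p - coeff p1 (degree p)"
      using coeff_pet_shift_degree min[OF p(1)] pos by (metis order.strict_trans2)
    have ne: "coeff ?q (degree p) \<noteq> 0"
    proof (cases "degree p = degree p1")
      case True
      then have "degree ?q = degree p" using le z(2) by simp
      then show ?thesis using p(3) by (metis leading_coeff_0_iff)
    next
      case False
      then have "degree p1 < degree p" using min[OF p(1)] by simp
      moreover then have "p \<noteq> 0" by auto
      ultimately show ?thesis using cf by (simp add: coeff_eq_0)
    qed
    then have deg: "degree ?q = degree p" using le le_degree by (metis le_antisym)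
    have "cl p \<noteq> cl p1" using ne cf by (auto simp: cl_def)
    then have "cl p \<in> C" using p(1) by (auto simp: C_def)
    moreover have "z = \<phi> (cl p)"
      using z(1) deg cf min[OF p(1)] by (auto simp: cl_def \<phi>_def coeff_eq_0)
    ultimately show "z \<in> \<phi> ` C" by blast
  qed
  then have "mset_set H \<subseteq># mset_set (\<phi> ` C)"
    using finC by (simp add: subset_imp_msubset_mset_set)
  moreover have "mset_set (\<phi> ` C) = image_mset \<phi> (mset_set C)"
    by (rule image_mset_mset_set[symmetric]) (auto simp: inj_on_def \<phi>_def split: if_splits)
  ultimately have "image_mset fst (mset_set H) \<subseteq># image_mset fst (image_mset \<phi> (mset_set C))"
    by (metis image_mset_subseteq_mono)
  also have "image_mset fst (image_mset \<phi> (mset_set C)) = image_mset fst (mset_set C)"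
    by (simp add: multiset.map_comp) (auto intro!: image_mset_cong simp: \<phi>_def)
  finally obtain J where J: "image_mset fst (mset_set C) = image_mset fst (mset_set H) + J"
    by (metis subset_mset.add_diff_inverse)
  have "cl ` G = insert (cl p1) C" using p1 by (auto simp: C_def)
  moreover have "cl p1 \<notin> C" by (simp add: C_def)
  ultimately have mG: "mset_set (cl ` G) = add_mset (cl p1) (mset_set C)"
    using finC by simp
  have fst_cl: "fst (cl p1) = degree p1" by (simp add: cl_def)
  have wG: "pet_weight G = image_mset fst (mset_set H) + (add_mset (degree p1) J)"
    unfolding pet_weight_def cl_def[symmetric] mG by (simp add: fst_cl J)
  have "cl ` G' = H \<union> L" "H \<inter> L = {}" by (auto simp: H_def L_def)
  then have wG': "pet_weight G' = image_mset fst (mset_set H) + image_mset fst (mset_set L)"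
    using finH finL unfolding pet_weight_def cl_def[symmetric]
    by (simp add: mset_set_Union)
  \<comment> \<open>In the multiset order the nonempty \<open>add_mset (degree p1) J\<close> is
    replaced by the degrees in \<open>L\<close>, all below \<open>degree p1\<close>.\<close>
  have "(pet_weight G', pet_weight G) \<in> mult less_than"
    unfolding wG wG' using finL
    by (intro one_step_implies_mult) (auto simp: L_def)
  then show ?thesis by (simp add: G'_def)
qed

section \<open>Colour focusing\<close>

text \<open>\<open>D\<close> is a set of differences whose configurations, all focused at
  \<open>x\<close>, are monochromatic of pairwise distinct colours.\<close>

definition focusing_bound ::
  "'a::linordered_field poly set \<Rightarrow> 'a poly \<Rightarrow> nat \<Rightarrow> nat \<Rightarrow> 'a set \<Rightarrow> 'a set \<Rightarrow> bool" where
  "focusing_bound G p1 k n X R \<longleftrightarrow> finite X \<and> finite R \<and> R \<subseteq> {0<..} \<and>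
    (\<forall>c :: 'a \<Rightarrow> nat. (\<forall>x. c x < k) \<longrightarrow>
       (\<exists>x\<in>X. \<exists>y\<in>R. \<forall>g\<in>G. c (x + poly g y) = c x) \<or>
       (\<exists>x\<in>X. \<exists>D\<subseteq>R. card D = n \<and> inj_on (\<lambda>d. c (x + poly p1 d)) D \<and>
          (\<forall>d\<in>D. (\<forall>g\<in>G. c (x + poly g d) = c (x + poly p1 d)) \<and> c (x + poly p1 d) \<noteq> c x)))"

text \<open>Induction on \<open>n\<close>. Points \<open>a\<close> are coloured by the colour
  pattern on \<open>a + S\<close>; the lower-weight family yields \<open>a\<close> and
  \<open>y\<close> such that adding the value at \<open>y\<close> of any polynomial in
  \<open>G'\<close> keeps the pattern. Moving the focus back by \<open>p1 y\<close> and the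
  differences up by \<open>y\<close> preserves the old colours, and the new difference
  \<open>y\<close> receives the colour of the old focus.\<close>

lemma colour_focusing:
  fixes G :: "'a::linordered_field poly set"
  assumes fin: "finite G" and p1: "p1 \<in> G"
    and zero: "\<And>p. p \<in> G \<Longrightarrow> coeff p 0 = 0"
    and lower: "\<And>D. finite D \<Longrightarrow> poly_vdW ((\<lambda>(p, d). pet_shift p1 p d) ` (G \<times> D) - {0})"
  shows "\<exists>X R. focusing_bound G p1 k n X R"
proof (induction n)
  case 0
  have "focusing_bound G p1 k 0 {0} {}"
    unfolding focusing_bound_def
    by (intro conjI allI impI disjI2 bexI exI[of _ "{}"]) auto
  then show ?case by blast
next
  case (Suc n)
  then obtain X R where "focusing_bound G p1 k n X R" by blast
  then have XR: "finite X" "finite R" "R \<subseteq> {0<..}"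
    "\<And>c :: 'a \<Rightarrow> nat. (\<forall>x. c x < k) \<Longrightarrow>
       (\<exists>x\<in>X. \<exists>y\<in>R. \<forall>g\<in>G. c (x + poly g y) = c x) \<or>
       (\<exists>x\<in>X. \<exists>D\<subseteq>R. card D = n \<and> inj_on (\<lambda>d. c (x + poly p1 d)) D \<and>
          (\<forall>d\<in>D. (\<forall>g\<in>G. c (x + poly g d) = c (x + poly p1 d)) \<and> c (x + poly p1 d) \<noteq> c x))"
    by (simp_all add: focusing_bound_def)
  define S where "S = X \<union> (\<lambda>(x, g, d). x + poly g d) ` (X \<times> G \<times> R)"
  \<comment> \<open>The difference 0 yields the polynomials \<open>p - p1\<close>, which control the
    configuration at the new difference \<open>y\<close>.\<close>
  define G' where "G' = (\<lambda>(p, d). pet_shift p1 p d) ` (G \<times> insert 0 R) - {0}"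
  have finS: "finite S" using XR fin by (simp add: S_def)
  have "poly_vdW G'" unfolding G'_def using lower XR(2) by blast
  moreover have "finite (PiE S (\<lambda>_. {..<k}))" using finS by (simp add: finite_PiE)
  ultimately obtain X2 R2 where "vdW_bound G' (PiE S (\<lambda>_. {..<k})) X2 R2"
    using poly_vdW_finite_range by blast
  then have XR2: "finite X2" "finite R2" "R2 \<subseteq> {0<..}"
    "\<And>c :: 'a \<Rightarrow> 'a \<Rightarrow> nat. (\<And>x. c x \<in> PiE S (\<lambda>_. {..<k})) \<Longrightarrow>
       \<exists>x\<in>X2. \<exists>y\<in>R2. \<forall>g\<in>G'. c (x + poly g y) = c x"
    by (simp_all add: vdW_bound_def)
  define X' where "X' = (\<lambda>(a, x). a + x) ` (X2 \<times> X) \<union>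
    (\<lambda>(a, x, y). a + x - poly p1 y) ` (X2 \<times> X \<times> R2)"
  define R' where "R' = R \<union> R2 \<union> (\<lambda>(d, y). d + y) ` (R \<times> R2)"
  have "focusing_bound G p1 k (Suc n) X' R'"
    unfolding focusing_bound_def
  proof (intro conjI allI impI)
    show "finite X'" "finite R'" using XR XR2 by (simp_all add: X'_def R'_def)
    show "R' \<subseteq> {0<..}" using XR(3) XR2(3) by (force simp: R'_def)
    fix c :: "'a \<Rightarrow> nat" assume c: "\<forall>x. c x < k"
    have "(\<lambda>s\<in>S. c (x + s)) \<in> PiE S (\<lambda>_. {..<k})" for x using c by auto
    from XR2(4)[of "\<lambda>x. \<lambda>s\<in>S. c (x + s)", OF this]
    obtain a y where ay: "a \<in> X2" "y \<in> R2"
      "\<And>q. q \<in> G' \<Longrightarrow> (\<lambda>s\<in>S. c (a + poly q y + s)) = (\<lambda>s\<in>S. c (a + s))"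
      by blast
    have y0: "y > 0" using ay(2) XR2(3) by auto
    have shift: "c (a + s + (poly p (d + y) - poly p d - poly p1 y)) = c (a + s)"
      if "p \<in> G" "d \<in> insert 0 R" "s \<in> S" for p d s
    proof (cases "pet_shift p1 p d = 0")
      case True
      then show ?thesis using poly_pet_shift[of p1 p d y] by simp
    next
      case False
      then have "pet_shift p1 p d \<in> G'" using that by (auto simp: G'_def)
      from fun_cong[OF ay(3)[OF this], of s] that(3) show ?thesis
        by (simp add: poly_pet_shift algebra_simps)
    qed
    from XR(4)[of "\<lambda>x. c (a + x)"] c consider
      (conf) x z where "x \<in> X" "z \<in> R" "\<forall>g\<in>G. c (a + (x + poly g z)) = c (a + x)"
    | (focus) x D where "x \<in> X" "D \<subseteq> R" "card D = n"
        "inj_on (\<lambda>d. c (a + (x + poly p1 d))) D"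
        "\<forall>d\<in>D. (\<forall>g\<in>G. c (a + (x + poly g d)) = c (a + (x + poly p1 d))) \<and>
           c (a + (x + poly p1 d)) \<noteq> c (a + x)"
      by auto
    then show "(\<exists>x\<in>X'. \<exists>y\<in>R'. \<forall>g\<in>G. c (x + poly g y) = c x) \<or>
       (\<exists>x\<in>X'. \<exists>D\<subseteq>R'. card D = Suc n \<and> inj_on (\<lambda>d. c (x + poly p1 d)) D \<and>
          (\<forall>d\<in>D. (\<forall>g\<in>G. c (x + poly g d) = c (x + poly p1 d)) \<and> c (x + poly p1 d) \<noteq> c x))"
    proof cases
      case conf
      have "a + x \<in> X'" using ay(1) conf(1) by (force simp: X'_def)
      moreover have "z \<in> R'" using conf(2) by (simp add: R'_def)
      ultimately show ?thesis using conf(3) by (metis add.assoc)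
    next
      case focus
      define x' where "x' = a + x - poly p1 y"
      define D' where "D' = insert y ((\<lambda>d. d + y) ` D)"
      have x': "x' \<in> X'" using ay focus(1) by (force simp: X'_def x'_def)
      have D': "D' \<subseteq> R'" using ay(2) focus(2) by (force simp: D'_def R'_def)
      have finD: "finite D" using focus(2) XR(2) finite_subset by blast
      have Dpos: "d > 0" if "d \<in> D" for d using that focus(2) XR(3) by auto
      have c_old: "c (x' + poly g (d + y)) = c (a + (x + poly g d))" if "g \<in> G" "d \<in> D" for g d
      proof -
        have "x + poly g d \<in> S" using that focus(1,2) by (force simp: S_def)
        from shift[OF that(1) _ this, of d] that focus(2) show ?thesis
          by (auto simp: x'_def algebra_simps)
      qed
      have c_new: "c (x' + poly g y) = c (a + x)" if "g \<in> G" for g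
      proof -
        have "x \<in> S" using focus(1) by (simp add: S_def)
        from shift[OF that _ this, of 0] zero[OF that] show ?thesis
          by (simp add: x'_def algebra_simps poly_0_coeff_0)
      qed
      have "y \<notin> (\<lambda>d. d + y) ` D" using Dpos by force
      then have "card D' = Suc n"
        using finD focus(3) by (simp add: D'_def card_image)
      moreover have "inj_on (\<lambda>d. c (x' + poly p1 d)) D'"
        unfolding D'_def inj_on_insert
      proof (intro conjI)
        show "inj_on (\<lambda>d. c (x' + poly p1 d)) ((\<lambda>d. d + y) ` D)"
          using focus(4) c_old[OF p1] by (auto simp: inj_on_def)
        \<comment> \<open>The new colour is that of the old focus \<open>a + x\<close>, which no old
          configuration has.\<close>
        show "c (x' + poly p1 y) \<notin> (\<lambda>d. c (x' + poly p1 d)) ` ((\<lambda>d. d + y) ` D - {y})"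
          using focus(5) c_old[OF p1] c_new[OF p1] by (auto simp: image_iff)
      qed
      moreover have mono: "\<forall>d\<in>D'. \<forall>g\<in>G. c (x' + poly g d) = c (x' + poly p1 d)"
      proof (intro ballI)
        fix d g assume dg: "d \<in> D'" "g \<in> G"
        consider "d = y" | d0 where "d0 \<in> D" "d = d0 + y"
          using dg(1) by (auto simp: D'_def)
        then show "c (x' + poly g d) = c (x' + poly p1 d)"
        proof cases
          case 1
          then show ?thesis using c_new[OF dg(2)] c_new[OF p1] by simp
        next
          case 2
          then have "c (a + (x + poly g d0)) = c (a + (x + poly p1 d0))"
            using focus(5) dg(2) by blast
          then show ?thesis using c_old[OF dg(2) 2(1)] c_old[OF p1 2(1)] 2(2) by simp
        qed
      qed
      \<comment> \<open>A configuration sharing the colour of the focus \<open>x'\<close> gives the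
        first alternative; if there is none, \<open>D'\<close> gives the second.\<close>
      moreover have ?thesis if "d \<in> D'" "c (x' + poly p1 d) = c x'" for d
        using mono that x' D' by (metis subsetD)
      ultimately show ?thesis using x' D' by blast
    qed
  qed
  then show ?case by blast
qed

text \<open>Induction on the weight, with \<open>p1\<close> of least degree. Focusing with
  \<open>n = k\<close> cannot end in its second alternative: \<open>k\<close> distinct colours, all
  different from that of the focus, would require \<open>k + 1\<close> colours.\<close>

theorem polynomial_van_der_Waerden:
  fixes G :: "'a::linordered_field poly set"
  assumes "finite G" and "\<And>p. p \<in> G \<Longrightarrow> coeff p 0 = 0"
  shows "poly_vdW G"
proof -
  have "poly_vdW G" if "finite G" "\<forall>p\<in>G. coeff p 0 = 0" "0 \<notin> G" for G :: "'a poly set"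
    using that
  proof (induction "pet_weight G" arbitrary: G rule: wf_induct_rule[OF wf_mult[OF wf_less_than]])
    case 1
    show ?case
    proof (cases "G = {}")
      case True
      then have "vdW_bound G {..<k} {0} {1}" for k :: nat by (simp add: vdW_bound_def)
      then show ?thesis unfolding poly_vdW_def by blast
    next
      case False
      define p1 where "p1 = arg_min_on degree G"
      have p1: "p1 \<in> G" "\<And>p. p \<in> G \<Longrightarrow> degree p1 \<le> degree p"
        using arg_min_if_finite[OF \<open>finite G\<close> False] arg_min_least[OF \<open>finite G\<close> False]
        by (auto simp: p1_def)
      \<comment> \<open>A nonzero polynomial with zero constant term is not constant; this is why
        the induction runs over families without 0.\<close>
      have pos: "degree p1 > 0"
        using 1(3,4) p1(1) by (metis gr0I leading_coeff_0_iff)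
      have lower: "poly_vdW ((\<lambda>(p, d). pet_shift p1 p d) ` (G \<times> D) - {0})" if "finite D" for D
        using 1(1)[OF pet_weight_decreases[OF 1(2) that p1 pos]] 1(2,3) p1(1) that
        by (force simp: coeff_0_pet_shift)
      show ?thesis
        unfolding poly_vdW_def
      proof
        fix k :: nat
        obtain X R where "focusing_bound G p1 k k X R"
          using colour_focusing[OF 1(2) p1(1) _ lower] 1(3) by blast
        then have XR: "finite X" "finite R" "R \<subseteq> {0<..}"
          "\<And>c :: 'a \<Rightarrow> nat. (\<forall>x. c x < k) \<Longrightarrow>
             (\<exists>x\<in>X. \<exists>y\<in>R. \<forall>g\<in>G. c (x + poly g y) = c x) \<or>
             (\<exists>x\<in>X. \<exists>D\<subseteq>R. card D = k \<and> inj_on (\<lambda>d. c (x + poly p1 d)) D \<and>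
                (\<forall>d\<in>D. (\<forall>g\<in>G. c (x + poly g d) = c (x + poly p1 d)) \<and>
                   c (x + poly p1 d) \<noteq> c x))"
          by (simp_all add: focusing_bound_def)
        have "\<exists>x\<in>X. \<exists>y\<in>R. \<forall>g\<in>G. c (x + poly g y) = c x" if c: "\<forall>x. c x < k" for c :: "'a \<Rightarrow> nat"
        proof (rule ccontr)
          assume "\<not> ?thesis"
          then obtain x D where D: "D \<subseteq> R" "card D = k" "inj_on (\<lambda>d. c (x + poly p1 d)) D"
            "\<forall>d\<in>D. c (x + poly p1 d) \<noteq> c x"
            using XR(4)[OF c] by blast
          have "(\<lambda>d. c (x + poly p1 d)) ` D \<subseteq> {..<k} - {c x}" using c D(4) by auto
          then have "card D \<le> card ({..<k} - {c x})"
            using D(3) by (metis card_image card_mono finite_Diff finite_lessThan)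
          then show False using D(2) c by (auto simp: card_Diff_singleton_if)
        qed
        then have "vdW_bound G {..<k} X R"
          using XR(1-3) by (simp add: vdW_bound_def)
        then show "\<exists>X R. vdW_bound G {..<k} X R" by blast
      qed
    qed
  qed
  from this[of "G - {0}"] assms have "poly_vdW (G - {0})" by auto
  moreover have "(\<forall>g\<in>G - {0}. c (x + poly g y) = c x) \<longleftrightarrow> (\<forall>g\<in>G. c (x + poly g y) = c x)"
    for c :: "'a \<Rightarrow> nat" and x y by force
  ultimately show ?thesis unfolding poly_vdW_def vdW_bound_def by simp
qed

section \<open>Polynomial recurrence in piecewise syndetic sets\<close>

text \<open>Colour \<open>s\<close> by an \<open>f\<close> in \<open>F\<close> taking
  \<open>t + e + s\<close> into \<open>A\<close>. If \<open>x\<close> and all \<open>x + g y\<close>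
  have colour \<open>f\<close>, then \<open>t + e + x + f\<close> lies in the return set
  \<open>B y\<close>. As \<open>x + f\<close> and \<open>y\<close> range over finite sets, the union
  of the \<open>B y\<close> is piecewise syndetic, and partition regularity selects one
  \<open>y\<close>.\<close>

lemma piecewise_syndetic_polynomial_recurrence:
  fixes A :: "'a::linordered_field set"
  assumes A: "piecewise_syndetic A" and G: "finite G" "\<And>g. g \<in> G \<Longrightarrow> coeff g 0 = 0"
  obtains y where "y > 0" "piecewise_syndetic {x \<in> A. \<forall>g\<in>G. x + poly g y \<in> A}"
proof -
  obtain F where F: "finite F" "thick {x. \<exists>f\<in>F. x + f \<in> A}"
    using A unfolding piecewise_syndetic_def by blast
  have "F \<noteq> {}" using thickD[OF F(2), of "{0}"] by auto
  then obtain f0 where f0: "f0 \<in> F" by blast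
  obtain X R where "vdW_bound G F X R"
    using poly_vdW_finite_range[OF polynomial_van_der_Waerden[OF G] F(1)] by blast
  then have XR: "finite X" "finite R" "R \<subseteq> {0<..}"
    "\<And>c :: 'a \<Rightarrow> 'a. (\<And>x. c x \<in> F) \<Longrightarrow> \<exists>x\<in>X. \<exists>y\<in>R. \<forall>g\<in>G. c (x + poly g y) = c x"
    by (simp_all add: vdW_bound_def)
  define S where "S = X \<union> (\<lambda>(x, g, y). x + poly g y) ` (X \<times> G \<times> R)"
  have finS: "finite S" using XR G by (simp add: S_def)
  define B where "B y = {x \<in> A. \<forall>g\<in>G. x + poly g y \<in> A}" for y
  define F' where "F' = (\<lambda>(x, f). x + f) ` (X \<times> F)"
  have "thick {x. \<exists>f\<in>F'. x + f \<in> (\<Union>y\<in>R. B y)}"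
    unfolding thick_def
  proof (intro allI impI)
    fix E :: "'a set" assume "finite E"
    then have "finite ((\<lambda>(e, s). e + s) ` (E \<times> S))" using finS by simp
    from thickD[OF F(2) this] obtain t where
      t: "\<And>e s. e \<in> E \<Longrightarrow> s \<in> S \<Longrightarrow> \<exists>f\<in>F. t + (e + s) + f \<in> A" by auto
    have "\<exists>f\<in>F'. t + e + f \<in> (\<Union>y\<in>R. B y)" if e: "e \<in> E" for e
    proof -
      \<comment> \<open>Off \<open>S\<close>, the default \<open>f0\<close> keeps all colours in
        \<open>F\<close>.\<close>
      define c where "c s = (if s \<in> S then SOME f. f \<in> F \<and> t + (e + s) + f \<in> A else f0)" for s
      have c: "c s \<in> F \<and> t + (e + s) + c s \<in> A" if "s \<in> S" for s
        using someI_ex[of "\<lambda>f. f \<in> F \<and> t + (e + s) + f \<in> A"] t[OF e that] that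
        by (auto simp: c_def)
      have "c s \<in> F" for s using c f0 by (cases "s \<in> S") (auto simp: c_def)
      from XR(4)[of c, OF this] obtain x y where
        xy: "x \<in> X" "y \<in> R" "\<And>g. g \<in> G \<Longrightarrow> c (x + poly g y) = c x" by blast
      have "x \<in> S" using xy by (simp add: S_def)
      note cx = c[OF this]
      have "t + e + (x + c x) + poly g y \<in> A" if "g \<in> G" for g
      proof -
        have "x + poly g y \<in> S" using xy that by (force simp: S_def)
        from c[OF this] xy(3)[OF that] show ?thesis by (simp add: algebra_simps)
      qed
      then have "t + e + (x + c x) \<in> B y" using cx by (simp add: B_def algebra_simps)
      then show ?thesis using xy(1,2) cx by (force simp: F'_def)
    qed
    then show "\<exists>t. \<forall>e\<in>E. t + e \<in> {x. \<exists>f\<in>F'. x + f \<in> (\<Union>y\<in>R. B y)}" by blast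
  qed
  moreover have "finite F'" using XR F by (simp add: F'_def)
  ultimately have "piecewise_syndetic (\<Union>y\<in>R. B y)"
    unfolding piecewise_syndetic_def by blast
  from piecewise_syndetic_UN[OF XR(2) this] show thesis
    using that XR(3) unfolding B_def by auto
qed

section \<open>Iterating recurrence and dilation\<close>

text \<open>\<open>H\<close> records, for each colour \<open>C\<close> met so far, a ratio \<open>Y\<close> such that dividing the current
  set \<open>B\<close> by \<open>Y powi e\<close> leads back into \<open>C\<close>. Each round of recurrence followed by dilation
  either meets a recorded colour again, which yields the configuration, or records a new one.\<close>

lemma recurrence_dilation_iteration:
  fixes B :: "'a::linordered_field set" and e :: int
  assumes "finite \<C>" "\<Union>\<C> = UNIV"
    and P: "finite P" "\<And>f. f \<in> P \<Longrightarrow> coeff f 0 = 0"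
    and "piecewise_syndetic B" "finite H" "snd ` H \<subseteq> \<C>"
    and "\<And>Y C x. (Y, C) \<in> H \<Longrightarrow> Y > 0 \<and> (Y powi e * x \<in> B \<longrightarrow> x \<in> C)"
  shows "\<exists>y>0. \<exists>C\<in>\<C>. infinite {x. x \<in> C \<and> y powi e * x \<in> C \<and> (\<forall>f\<in>P. x + poly f y \<in> C)}"
  using assms(5-)
proof (induction "card (\<C> - snd ` H)" arbitrary: B H rule: less_induct)
  case less
  \<comment> \<open>At \<open>y\<close> these polynomials take the value
    \<open>Y powi e * f (Y * y)\<close>: the shift \<open>f (Y * y)\<close> wanted in an earlier
    colour, rescaled to the current \<open>B\<close>.\<close>
  define G where "G = (\<lambda>((Y, C), f). smult (Y powi e) (pcompose f [:0, Y:])) ` (H \<times> P)"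
  have coeffG: "coeff g 0 = 0" if "g \<in> G" for g
  proof -
    have "poly g 0 = 0" using that P(2) by (auto simp: G_def poly_pcompose poly_0_coeff_0)
    then show ?thesis by (simp add: poly_0_coeff_0)
  qed
  have finG: "finite G" using less.prems(2) P by (simp add: G_def)
  obtain y where y: "y > 0" "piecewise_syndetic {x \<in> B. \<forall>g\<in>G. x + poly g y \<in> B}"
    using piecewise_syndetic_polynomial_recurrence[OF less.prems(1) finG coeffG] by blast
  define D where "D = {x \<in> B. \<forall>g\<in>G. x + poly g y \<in> B}"
  define z where "z = y powi e"
  have z: "z \<noteq> 0" using y(1) by (simp add: z_def)
  have "piecewise_syndetic ((*) z ` D)"
    using piecewise_syndetic_dilate y(2) z unfolding D_def by blast
  moreover have "(*) z ` D = (\<Union>C\<in>\<C>. (*) z ` D \<inter> C)" using assms(2) by blast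
  ultimately obtain C' where C': "C' \<in> \<C>" "piecewise_syndetic ((*) z ` D \<inter> C')"
    using piecewise_syndetic_UN[OF assms(1)] by metis
  define B' where "B' = (*) z ` D \<inter> C'"
  \<comment> \<open>Cancelling the newest factor \<open>y powi e\<close> leads back into
    \<open>D\<close>, hence into \<open>B\<close>, where the recorded ratios apply.\<close>
  have back_D: "Y powi e * x \<in> D" if x: "(y * Y) powi e * x \<in> B'" for Y x
  proof -
    obtain d where "d \<in> D" "z * (Y powi e * x) = z * d"
      using x by (auto simp: B'_def z_def power_int_mult_distrib mult.assoc)
    then show ?thesis using z by simp
  qed
  show ?case
  proof (cases "C' \<in> snd ` H")
    case True
    then obtain Y where Y: "(Y, C') \<in> H" by force
    have Ypos: "Y > 0" using less.prems(4)[OF Y] by blast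
    \<comment> \<open>The colour \<open>C'\<close> recurs. The required step is
      \<open>y * Y\<close>, and \<open>B'\<close> divided by \<open>w\<close> is the infinite
      set.\<close>
    define w where "w = (y * Y) powi e"
    have w: "w \<noteq> 0" using y(1) Ypos by (simp add: w_def)
    have sub: "x \<in> C' \<and> w * x \<in> C' \<and> (\<forall>f\<in>P. x + poly f (y * Y) \<in> C')" if x: "w * x \<in> B'" for x
    proof (intro conjI ballI)
      have xD: "Y powi e * x \<in> D" using back_D x by (simp add: w_def)
      then show "x \<in> C'" using less.prems(4)[OF Y] by (simp add: D_def)
      show "w * x \<in> C'" using x by (simp add: B'_def)
      fix f assume "f \<in> P"
      then have "smult (Y powi e) (pcompose f [:0, Y:]) \<in> G" using Y by (force simp: G_def)
      then have "Y powi e * (x + poly f (y * Y)) \<in> B"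
        using xD by (auto simp: D_def poly_pcompose distrib_left)
      then show "x + poly f (y * Y) \<in> C'" using less.prems(4)[OF Y] by blast
    qed
    have "infinite ((\<lambda>b. b / w) ` B')"
      using piecewise_syndetic_infinite[OF C'(2)] w
      by (simp add: B'_def finite_image_iff inj_on_def)
    moreover have "(\<lambda>b. b / w) ` B' \<subseteq>
        {x. x \<in> C' \<and> w * x \<in> C' \<and> (\<forall>f\<in>P. x + poly f (y * Y) \<in> C')}"
    proof (intro image_subsetI CollectI)
      fix b assume "b \<in> B'"
      then show "b / w \<in> C' \<and> w * (b / w) \<in> C' \<and> (\<forall>f\<in>P. b / w + poly f (y * Y) \<in> C')"
        by (intro sub) (simp add: w)
    qed
    ultimately have "infinite {x. x \<in> C' \<and> w * x \<in> C' \<and> (\<forall>f\<in>P. x + poly f (y * Y) \<in> C')}"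
      by (rule infinite_super[rotated])
    moreover have "y * Y > 0" using y(1) Ypos by simp
    ultimately show ?thesis using C'(1) unfolding w_def by blast
  next
    case False
    \<comment> \<open>\<open>B'\<close> lies in \<open>C'\<close> itself, hence the ratio 1; the
      older ratios absorb \<open>y\<close>. Fewer colours remain unrecorded, so the induction
      applies.\<close>
    define H' where "H' = insert (1, C') ((\<lambda>(Y, C). (y * Y, C)) ` H)"
    have snd: "snd ` H' = insert C' (snd ` H)"
      by (simp add: H'_def image_image case_prod_beta)
    show ?thesis
    proof (rule less.hyps)
      have "\<C> - snd ` H' \<subset> \<C> - snd ` H" using snd False C'(1) by auto
      then show "card (\<C> - snd ` H') < card (\<C> - snd ` H)"
        using assms(1) by (simp add: psubset_card_mono)
      show "piecewise_syndetic B'" using C'(2) by (simp add: B'_def)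
      show "finite H'" using less.prems(2) by (simp add: H'_def)
      show "snd ` H' \<subseteq> \<C>" using snd C'(1) less.prems(3) by auto
      fix Y C x assume "(Y, C) \<in> H'"
      then consider "Y = 1" "C = C'" | Y0 where "(Y0, C) \<in> H" "Y = y * Y0"
        by (auto simp: H'_def)
      then show "Y > 0 \<and> (Y powi e * x \<in> B' \<longrightarrow> x \<in> C)"
      proof cases
        case 1
        then show ?thesis by (simp add: B'_def)
      next
        case 2
        then show ?thesis using less.prems(4)[OF 2(1), of x] back_D[of Y0 x] y(1)
          by (auto simp: D_def)
      qed
    qed
  qed
qed

section \<open>Configurations in finite colourings of the rationals\<close>

text \<open>The iteration starts at \<open>UNIV\<close> with no colour recorded; discarding 0 at the
  end keeps the set infinite.\<close>

lemma monochromatic_dilate_polynomial_shifts: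
  fixes e :: int and P :: "rat poly set"
  assumes "finite_coloring \<C>" "finite P" "\<And>f. f \<in> P \<Longrightarrow> coeff f 0 = 0"
  shows "\<exists>y A. y \<noteq> 0 \<and> infinite A \<and> A \<subseteq> UNIV - {0} \<and>
    monochromatic \<C> (A \<union> ((y powi e) *o A) \<union> (A + {poly f y | f. f \<in> P}))"
proof -
  have "finite \<C>" "\<Union>\<C> = UNIV"
    using assms(1) by (auto simp: finite_coloring_def partition_on_def)
  then obtain y C where y: "y > 0" "C \<in> \<C>"
    "infinite {x. x \<in> C \<and> y powi e * x \<in> C \<and> (\<forall>f\<in>P. x + poly f y \<in> C)}"
    using recurrence_dilation_iteration[OF _ _ assms(2,3) piecewise_syndetic_UNIV, of \<C> "{}" e]
    by auto
  define A where "A = {x. x \<in> C \<and> y powi e * x \<in> C \<and> (\<forall>f\<in>P. x + poly f y \<in> C)} - {0}"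
  have "A \<union> ((y powi e) *o A) \<union> (A + {poly f y | f. f \<in> P}) \<subseteq> C"
    by (auto simp: A_def elt_set_times_def set_plus_def)
  then have "monochromatic \<C> (A \<union> ((y powi e) *o A) \<union> (A + {poly f y | f. f \<in> P}))"
    using y(2) by (auto simp: monochromatic_def)
  moreover have "infinite A" "A \<subseteq> UNIV - {0}" using y(3) by (auto simp: A_def)
  moreover have "y \<noteq> 0" using y(1) by simp
  ultimately show ?thesis by (intro exI conjI)
qed

theorem theorem1p2:
  fixes k a :: nat and p :: "nat \<Rightarrow> rat poly" and \<C> :: "rat set set"
  assumes "k \<ge> 1" and "a \<ge> 1"
    and "\<And>i. i \<in> {1..k} \<Longrightarrow> coeff (p i) 0 = 0"
    and "finite_coloring \<C>"
  shows "(\<exists>(y::rat) (A::rat set). y \<noteq> 0 \<and> infinite A \<and> A \<subseteq> UNIV - {0} \<and>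
            monochromatic \<C>
              (A \<union> ((y powi (- int a)) *o A) \<union> (A + {poly (p i) y | i. i \<in> {1..k}})))
       \<and> (\<exists>(u::rat) (B::rat set). u \<noteq> 0 \<and> infinite B \<and> B \<subseteq> UNIV - {0} \<and>
            monochromatic \<C>
              (B \<union> ((u ^ a) *o B) \<union> (B + {poly (p i) u | i. i \<in> {1..k}})))"
proof -
  have "finite (p ` {1..k})" "\<And>f. f \<in> p ` {1..k} \<Longrightarrow> coeff f 0 = 0"
    using assms(3) by auto
  note * = monochromatic_dilate_polynomial_shifts[OF assms(4) this]
  have eq: "{poly f y | f. f \<in> p ` {1..k}} = {poly (p i) y | i. i \<in> {1..k}}" for y
    by blast
  show ?thesis
    using *[of "- int a"] *[of "int a"] unfolding eq power_int_of_nat by blast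
qed

end
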